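(* If $X$ has the rGB1-IWei distribution with parameter $\boldsymbol{\eta}=(\gamma,\theta,a,b,c)$, then the $r$-th moment $\mu_r(\boldsymbol{\eta})=E(X^r)$ of $X$ is given by $$\mu_r(\boldsymbol{\eta})=\frac{c}{B(a,b)}\sum_{j_1=0}^{\infty}p_{j_1,b}\left(\sum_{j_2=0}^{\infty}\frac{p_{j_2,c(a+j_1)}}{j_2+1}\cdot\bigl[(j_2+1)\gamma\bigr]^{\frac{r}{\theta}}\cdot\Gamma\left(1-\frac{r}{\theta}\right)\right).$$
   Context: $\Gamma$ is the Gamma function and $B(a,b)=\Gamma(a)\Gamma(b)/\Gamma(a+b)$ is the Beta function. A positive random variable $X$ has the rGB1-IWei (reflected generalized beta of first type Inverse Weibull) distribution with parameters $\gamma,\theta,a,b,c>0$ if it has the density, for $x>0$, $$f(x)=\frac{c\,\gamma\,\theta\,x^{-\theta-1}e^{-\gamma x^{-\theta}}}{B(a,b)}\left[1-e^{-\gamma x^{-\theta}}\right]^{ac-1}\left(1-\left[1-e^{-\gamma x^{-\theta}}\right]^{c}\right)^{b-1}.$$ The coefficients are $p_{j,s}=\dfrac{(-1)^j\,\Gamma(s)}{\Gamma(s-j)\,\Gamma(j+1)}$, i.e. the coefficients of the power series $(1-z)^{s-1}=\sum_{j=0}^\infty p_{j,s}z^j$.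
   Formalization: It is additionally assumed that the r-th moment E(X^r) is finite and that 1 − r/θ is not a pole of Γ (r/θ is not a positive integer); without this the formula fails, e.g. for a=b=c=θ=1, r=3/2. *)

theory Defs
  imports "HOL-Probability.Probability"
begin

text \<open>
  The density on the positive half-line, extended by \<open>0\<close>. All bases of \<open>powr\<close> are positive for
  \<open>x > 0\<close>, so \<open>powr\<close> is the ordinary real power there.
\<close>

definition rGB1_IWei_density ::
    "real \<Rightarrow> real \<Rightarrow> real \<Rightarrow> real \<Rightarrow> real \<Rightarrow> real \<Rightarrow> real" where
  "rGB1_IWei_density \<gamma> \<theta> a b c x =
    (if x > 0 then
       c * \<gamma> * \<theta> * x powr (- \<theta> - 1) * exp (- \<gamma> * x powr (- \<theta>)) / Beta a b
       * (1 - exp (- \<gamma> * x powr (- \<theta>))) powr (a * c - 1)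
       * (1 - (1 - exp (- \<gamma> * x powr (- \<theta>))) powr c) powr (b - 1)
     else 0)"

text \<open>
  If \<open>s\<close> is a positive integer and \<open>j \<ge> s\<close>, then \<open>s - j\<close> is a pole of \<open>Gamma\<close>. There
  \<open>Gamma (s - j) = 0\<close> and division by \<open>0\<close> yields \<open>0\<close>, which agrees with the usual reading
  \<open>1 / \<Gamma>(s - j) = 0\<close> and with the coefficients of the (finite) expansion of \<open>(1 - z)^(s - 1)\<close>.
\<close>

definition p_coeff :: "nat \<Rightarrow> real \<Rightarrow> real" where
  "p_coeff j s = (- 1) ^ j * Gamma s / (Gamma (s - real j) * Gamma (real j + 1))"

end

(* Put alpha = r / theta. The substitution t = gamma x^(-theta) turns the moment into a constant times
   the integral over t > 0 of t^(-alpha) e^(-t) (1 - e^(-t))^(ac - 1) (1 - (1 - e^(-t))^c)^(b - 1).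
   Expanding the last factor binomially leaves the integrals
   K(alpha, s, k) = \<integral> t^(-alpha) e^(-kt) (1 - e^(-t))^(s - 1) dt with k = 1 and s = c (a + j).
   Binomial coefficients eventually have constant sign, so dominated convergence justifies termwise
   integration. For alpha < 1 expanding (1 - e^(-t))^(s - 1) as well gives Gamma integrals.
   The moment exists for all alpha < ac, however, and for alpha > 1 the terms of that expansion are
   not integrable. There the identity for K follows by induction from
   (1 - alpha) K(alpha, s, k) = k K(alpha - 1, s, k) - (s - 1) K(alpha - 1, s - 1, k + 1),
   an integration by parts. *)

theory Submission
  imports Defs "HOL-Real_Asymp.Real_Asymp"
begin

section \<open>Gamma-type integrals over the positive half-line\<close>

abbreviation halfline :: "real measure" where
  "halfline \<equiv> restrict_space lborel {0<..}"

text \<open>The integrand of K(\<alpha>, s, k). For \<alpha> = 0 the substitution u = e^(-t) turns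
  its integral over t > 0 into the Beta function B(k, s); in general a factor (-ln u)^(-\<alpha>) is
  inserted.\<close>

definition beta_exp_kernel :: "real \<Rightarrow> real \<Rightarrow> real \<Rightarrow> real \<Rightarrow> real" where
  "beta_exp_kernel \<alpha> s k t = t powr (- \<alpha>) * exp (- (k * t)) * (1 - exp (- t)) powr (s - 1)"

lemma borel_measurable_beta_exp_kernel [measurable]:
  "beta_exp_kernel \<alpha> s k \<in> borel_measurable borel"
  unfolding beta_exp_kernel_def by measurable

lemma borel_measurable_halfline:
  "f \<in> borel_measurable borel \<Longrightarrow> f \<in> borel_measurable halfline"
  by (simp add: measurable_restrict_space1)

text \<open>Euler's integral, rescaled by t -> k t. Working with nonnegative integrals yields
  integrability and the value together.\<close>

lemma has_bochner_integral_Gamma_scaled: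
  fixes x k :: real
  assumes "x > 0" "k > 0"
  shows "has_bochner_integral halfline (\<lambda>t. t powr (x - 1) * exp (- (k * t))) (Gamma x / k powr x)"
proof -
  have "ennreal (Gamma x) = nn_integral lborel (\<lambda>t. ennreal (indicator {0..} t * t powr (x - 1) / exp t))"
    using Gamma_conv_nn_integral_real[OF \<open>x > 0\<close>] .
  also have "\<dots> = ennreal \<bar>k\<bar> * nn_integral lborel
      (\<lambda>t. ennreal (indicator {0..} (0 + k * t) * (0 + k * t) powr (x - 1) / exp (0 + k * t)))"
    using \<open>k > 0\<close> by (intro nn_integral_real_affine) auto
  also have "\<dots> = nn_integral lborel
      (\<lambda>t. ennreal k * ennreal (indicator {0..} (0 + k * t) * (0 + k * t) powr (x - 1) / exp (0 + k * t)))"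
    using \<open>k > 0\<close> by (subst nn_integral_cmult) auto
  also have "\<dots> = nn_integral lborel
      (\<lambda>t. ennreal (k powr x) * ennreal (indicator {0<..} t *\<^sub>R (t powr (x - 1) * exp (- (k * t)))))"
  \<comment> \<open>Discarding the null set {0} reconciles the closed and the open half-line; for t
    > 0 the integrands agree by k (k t)^(x - 1) = k^x t^(x - 1).\<close>
  proof (intro nn_integral_cong_AE, rule AE_mp[OF AE_lborel_singleton[of 0]], rule AE_I2, rule impI)
    fix t :: real assume "t \<noteq> 0"
    then show "ennreal k * ennreal (indicator {0..} (0 + k * t) * (0 + k * t) powr (x - 1) / exp (0 + k * t))
      = ennreal (k powr x) * ennreal (indicator {0<..} t *\<^sub>R (t powr (x - 1) * exp (- (k * t))))"
      using \<open>k > 0\<close>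
      by (auto simp: indicator_def zero_le_mult_iff powr_mult powr_diff exp_minus field_simps
          simp flip: ennreal_mult' ennreal_mult'')
  qed
  also have "\<dots> = ennreal (k powr x) *
      nn_integral lborel (\<lambda>t. ennreal (indicator {0<..} t *\<^sub>R (t powr (x - 1) * exp (- (k * t)))))"
    by (subst nn_integral_cmult) auto
  finally have G: "ennreal (Gamma x) = ennreal (k powr x) *
      nn_integral lborel (\<lambda>t. ennreal (indicator {0<..} t *\<^sub>R (t powr (x - 1) * exp (- (k * t)))))" .
  have "nn_integral lborel (\<lambda>t. ennreal (indicator {0<..} t *\<^sub>R (t powr (x - 1) * exp (- (k * t)))))
      = ennreal (1 / k powr x) * (ennreal (k powr x) * nn_integral lborel
        (\<lambda>t. ennreal (indicator {0<..} t *\<^sub>R (t powr (x - 1) * exp (- (k * t))))))"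
    using \<open>k > 0\<close> by (simp add: mult.assoc[symmetric] flip: ennreal_mult')
  also have "\<dots> = ennreal (Gamma x / k powr x)"
    unfolding G[symmetric] by (simp flip: ennreal_mult')
  finally have N: "nn_integral lborel (\<lambda>t. ennreal (indicator {0<..} t *\<^sub>R (t powr (x - 1) * exp (- (k * t)))))
      = ennreal (Gamma x / k powr x)" .
  show ?thesis
    using N \<open>x > 0\<close> Gamma_real_pos[of x]
    by (subst has_bochner_integral_restrict_space)
      (auto intro!: has_bochner_integral_nn_integral simp: indicator_def)
qed

lemma integrable_Gamma_kernel:
  fixes \<alpha> k :: real
  assumes "\<alpha> < 1" "k > 0"
  shows "integrable halfline (\<lambda>t. t powr (- \<alpha>) * exp (- (k * t)))"
  using has_bochner_integral_Gamma_scaled[of "1 - \<alpha>" k] assms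
  by (auto dest: integrable.intros)

text \<open>The last two bounds come from 1 + u \<le> e^u. They squeeze (1 - e^(-t)) / t between
  e^(-t) and 1, which controls powers of 1 - e^(-t) with exponents of either sign.\<close>

lemma exp_neg_bounds:
  fixes t :: real
  assumes "t > 0"
  shows "0 < 1 - exp (- t)" "1 - exp (- t) < 1" "1 - exp (- t) \<le> t" "t * exp (- t) \<le> 1 - exp (- t)"
proof -
  have "1 + t \<le> exp t" by (rule exp_ge_add_one_self)
  then show "t * exp (- t) \<le> 1 - exp (- t)"
    by (simp add: exp_minus field_simps)
  show "1 - exp (- t) \<le> t"
    using exp_ge_add_one_self[of "- t"] by simp
qed (use assms in auto)

lemma beta_exp_kernel_nonneg: "0 \<le> beta_exp_kernel \<alpha> s k t"
  by (simp add: beta_exp_kernel_def)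

text \<open>The kernel behaves like t^(s - 1 - \<alpha>) near 0 and like e^(-kt) at infinity, so a
  Gamma integrand dominates it.\<close>

lemma beta_exp_kernel_integrable:
  assumes "0 < s" "\<alpha> < s" "1 \<le> k"
  shows "integrable halfline (beta_exp_kernel \<alpha> s k)"
proof -
  \<comment> \<open>A decay rate that serves both cases: for s \<ge> 1 the rate k survives, while
    for s < 1 the bound (t e^(-t))^(s - 1) brings in the growing factor e^((1 - s) t).\<close>
  define m where "m = min k (k - 1 + s)"
  have "m > 0" using assms by (auto simp: m_def)
  show ?thesis
  proof (rule Bochner_Integration.integrable_bound)
    show "integrable halfline (\<lambda>t. t powr (- (\<alpha> - s + 1)) * exp (- (m * t)))"
      using assms \<open>m > 0\<close> by (intro integrable_Gamma_kernel) auto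
    show "AE t in halfline. norm (beta_exp_kernel \<alpha> s k t) \<le> norm (t powr (- (\<alpha> - s + 1)) * exp (- (m * t)))"
    proof (rule AE_I2)
      fix t :: real assume "t \<in> space halfline"
      then have "t > 0" by (simp add: space_restrict_space)
      note b = exp_neg_bounds[OF this]
      have m: "m \<le> k" "m \<le> k - 1 + s" by (auto simp: m_def)
      have "exp (- (k * t)) * (1 - exp (- t)) powr (s - 1) \<le> t powr (s - 1) * exp (- (m * t))"
      proof (cases "s \<ge> 1")
        case True
        have "(1 - exp (- t)) powr (s - 1) \<le> t powr (s - 1)"
          using b True by (intro powr_mono2) auto
        moreover have "exp (- (k * t)) \<le> exp (- (m * t))"
          using m \<open>t > 0\<close> by (simp add: mult_right_mono)
        ultimately show ?thesis
          by (metis mult.commute mult_mono exp_ge_zero powr_ge_zero)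
      next
        case False
        have "(1 - exp (- t)) powr (s - 1) \<le> (t * exp (- t)) powr (s - 1)"
          using b False \<open>t > 0\<close> by (intro powr_mono2') auto
        also have "\<dots> = t powr (s - 1) * exp (- (s - 1) * t)"
          using \<open>t > 0\<close> by (simp add: powr_mult exp_powr_real algebra_simps)
        finally have "exp (- (k * t)) * (1 - exp (- t)) powr (s - 1)
            \<le> exp (- (k * t)) * (t powr (s - 1) * exp (- (s - 1) * t))"
          by (intro mult_left_mono) auto
        also have "\<dots> = t powr (s - 1) * exp (- ((k - 1 + s) * t))"
          by (simp add: algebra_simps flip: exp_add)
        also have "\<dots> \<le> t powr (s - 1) * exp (- (m * t))"
          using m \<open>t > 0\<close> by (intro mult_left_mono) (auto intro: mult_right_mono)
        finally show ?thesis .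
      qed
      then have "t powr (- \<alpha>) * (exp (- (k * t)) * (1 - exp (- t)) powr (s - 1))
          \<le> t powr (- \<alpha>) * (t powr (s - 1) * exp (- (m * t)))"
        by (intro mult_left_mono) auto
      also have "\<dots> = t powr (- (\<alpha> - s + 1)) * exp (- (m * t))"
        by (simp add: algebra_simps flip: powr_add)
      finally show "norm (beta_exp_kernel \<alpha> s k t) \<le> norm (t powr (- (\<alpha> - s + 1)) * exp (- (m * t)))"
        by (simp add: beta_exp_kernel_def mult.assoc)
    qed
  qed (intro borel_measurable_halfline borel_measurable_beta_exp_kernel)
qed

section \<open>Termwise integration of series\<close>

text \<open>Beyond index \<open>N\<close> the terms have a single sign, so sums of their absolute
  values stay below the modulus of the remainder \<open>S\<close> minus the first \<open>N\<close>
  terms. The dominating function is thus built from \<open>S\<close> and finitely many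
  terms.\<close>

lemma sums_integral_eventually_const_sign:
  fixes f :: "nat \<Rightarrow> 'a \<Rightarrow> real"
  assumes f: "\<And>j. integrable M (f j)" and S: "integrable M S"
    and sums: "\<And>x. x \<in> space M \<Longrightarrow> (\<lambda>j. f j x) sums S x"
    and sign: "\<And>j x. j \<ge> N \<Longrightarrow> x \<in> space M \<Longrightarrow> \<bar>f j x\<bar> = e * f j x"
    and e: "\<bar>e\<bar> = 1"
  shows "(\<lambda>j. integral\<^sup>L M (f j)) sums integral\<^sup>L M S"
proof -
  have "(\<lambda>n. integral\<^sup>L M (\<lambda>x. \<Sum>j<n. f j x)) \<longlonglongrightarrow> integral\<^sup>L M S"
  proof (rule integral_dominated_convergence)
    show "integrable M (\<lambda>x. (\<Sum>j<N. \<bar>f j x\<bar>) + \<bar>S x - (\<Sum>j<N. f j x)\<bar>)"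
      using f S by auto
    show "AE x in M. (\<lambda>n. \<Sum>j<n. f j x) \<longlonglongrightarrow> S x"
      using sums by (auto simp: sums_def)
    fix n
    show "AE x in M. norm (\<Sum>j<n. f j x) \<le> (\<Sum>j<N. \<bar>f j x\<bar>) + \<bar>S x - (\<Sum>j<N. f j x)\<bar>"
    proof (rule AE_I2)
      fix x assume x: "x \<in> space M"
      have tail: "(\<lambda>j. e * f (j + N) x) sums (e * (S x - (\<Sum>j<N. f j x)))"
        using sums_split_initial_segment[OF sums[OF x], of N] by (intro sums_mult) auto
      have nn: "e * f (j + N) x \<ge> 0" for j using sign[of "j + N" x] x by (metis abs_ge_zero le_add2)
      have "norm (\<Sum>j<n. f j x) \<le> (\<Sum>j<n. \<bar>f j x\<bar>)" by (simp add: sum_abs)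
      \<comment> \<open>Enlarging the range to \<open>N + n\<close> allows a split at
        \<open>N\<close> without distinguishing n < N from n \<ge> N.\<close>
      also have "\<dots> \<le> (\<Sum>j<N + n. \<bar>f j x\<bar>)" by (intro sum_mono2) auto
      also have "\<dots> = (\<Sum>j<N. \<bar>f j x\<bar>) + (\<Sum>j<n. \<bar>f (j + N) x\<bar>)"
        using sum.atLeastLessThan_concat[of 0 N "N + n" "\<lambda>j. \<bar>f j x\<bar>"]
          sum.shift_bounds_nat_ivl[of "\<lambda>j. \<bar>f j x\<bar>" 0 N n]
        by (simp add: lessThan_atLeast0 add.commute)
      also have "(\<Sum>j<n. \<bar>f (j + N) x\<bar>) = (\<Sum>j<n. e * f (j + N) x)"
        using sign x by (intro sum.cong) auto
      also have "\<dots> \<le> e * (S x - (\<Sum>j<N. f j x))"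
        using sum_le_suminf[OF sums_summable[OF tail], of "{..<n}"] nn sums_unique[OF tail] by auto
      also have "\<dots> \<le> \<bar>S x - (\<Sum>j<N. f j x)\<bar>"
        using e by (metis abs_ge_self abs_mult mult_1)
      finally show "norm (\<Sum>j<n. f j x) \<le> (\<Sum>j<N. \<bar>f j x\<bar>) + \<bar>S x - (\<Sum>j<N. f j x)\<bar>" by simp
    qed
  qed (use f S in auto)
  then show ?thesis using f by (simp add: sums_def)
qed

section \<open>The coefficients of the binomial series\<close>

text \<open>Since s > 0, \<open>Gamma s\<close> is no pole. At poles of Gamma(s - j) the convention
  x / 0 = 0 gives 0, as does the binomial coefficient.\<close>

lemma p_coeff_eq_gbinomial:
  assumes "s > 0"
  shows "p_coeff j s = (- 1) ^ j * (s - 1 gchoose j)"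
proof -
  have "s \<notin> \<int>\<^sub>\<le>\<^sub>0" using assms by (auto elim!: nonpos_Ints_cases)
  then show ?thesis
    using gbinomial_Gamma[of "s - 1" j] Gamma_fact[of j, where 'a = real]
    by (simp add: p_coeff_def add.commute mult.commute)
qed

lemma p_coeff_Suc:
  assumes "s > 0"
  shows "real (Suc j) * p_coeff (Suc j) s = (real j + 1 - s) * p_coeff j s"
  using gbinomial_mult_1[of "s - 1" j]
  by (simp add: p_coeff_eq_gbinomial[OF assms] algebra_simps)

text \<open>Trades the parameter s - 1 for s at the cost of an index shift. This is how the term
  K(\<alpha> - 1, s - 1, k + 1) of the integration by parts is brought back to coefficients with
  parameter s.\<close>

lemma p_coeff_absorption:
  assumes "s > 1"
  shows "(s - 1) * p_coeff j (s - 1) = - (real (Suc j) * p_coeff (Suc j) s)"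
proof -
  have "real (Suc j) * p_coeff (Suc j) s = (- 1) ^ Suc j * (real (Suc j) * (s - 1 gchoose Suc j))"
    using assms by (simp add: p_coeff_eq_gbinomial)
  also have "real (Suc j) * (s - 1 gchoose Suc j) = (s - 1) * (s - 1 - 1 gchoose j)"
    using gbinomial_absorption[of j "s - 1"] by simp
  finally show ?thesis
    using assms by (simp add: p_coeff_eq_gbinomial)
qed

lemma p_coeff_sums:
  assumes "s > 0" "\<bar>z\<bar> < 1"
  shows "(\<lambda>j. p_coeff j s * z ^ j) sums (1 - z) powr (s - 1)"
  using gen_binomial_real[of "- z" "s - 1"] assms
  by (simp add: p_coeff_eq_gbinomial power_minus[of z] mult_ac)

text \<open>The ratio of consecutive coefficients is (j + 1 - s) / (j + 1), which is positive once j
  \<ge> s.\<close>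

lemma p_coeff_eventually_const_sign:
  assumes "s > 0"
  obtains N e where "\<bar>e\<bar> = 1" "\<And>j. j \<ge> N \<Longrightarrow> \<bar>p_coeff j s\<bar> = e * p_coeff j s"
proof -
  obtain N where N: "real N \<ge> s" using real_arch_simple by blast
  \<comment> \<open>The sign of the coefficient at \<open>N\<close>, set to 1 if that coefficient is
    0, as happens for a positive integer s.\<close>
  define e where "e = (if p_coeff N s \<ge> 0 then 1 else - 1 :: real)"
  have "e * p_coeff j s \<ge> 0" if "j \<ge> N" for j
    using that
  proof (induction j rule: dec_induct)
    case base
    then show ?case by (auto simp: e_def)
  next
    case (step j)
    have "0 \<le> (real j + 1 - s) * (e * p_coeff j s)"
      using step.hyps N by (intro mult_nonneg_nonneg[OF _ step.IH]) auto
    also have "\<dots> = real (Suc j) * (e * p_coeff (Suc j) s)"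
      using p_coeff_Suc[OF assms, of j] by (simp add: mult.left_commute)
    finally show ?case by (subst (asm) zero_le_mult_iff) linarith
  qed
  then have "\<bar>p_coeff j s\<bar> = e * p_coeff j s" if "j \<ge> N" for j
    using that by (auto simp: e_def split: if_splits)
  moreover have "\<bar>e\<bar> = 1" by (simp add: e_def)
  ultimately show ?thesis using that by blast
qed

section \<open>The series for K(\<alpha>, s, k)\<close>

text \<open>After expansion in powers of e^(-t) the j-th term is a Gamma integrand of rate j + k,
  integrable at 0 because \<alpha> < 1.\<close>

lemma beta_exp_integral_sums_lt_1:
  assumes "\<alpha> < 1" "0 < s" "\<alpha> < s" "1 \<le> k"
  shows "(\<lambda>j. Gamma (1 - \<alpha>) * p_coeff j s * (real j + k) powr (\<alpha> - 1))
    sums integral\<^sup>L halfline (beta_exp_kernel \<alpha> s k)"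
proof -
  obtain N e where e: "\<bar>e\<bar> = 1" "\<And>j. j \<ge> N \<Longrightarrow> \<bar>p_coeff j s\<bar> = e * p_coeff j s"
    using p_coeff_eventually_const_sign[OF \<open>0 < s\<close>] by blast
  define f where "f j t = p_coeff j s * (t powr (- \<alpha>) * exp (- ((real j + k) * t)))" for j t
  have "has_bochner_integral halfline (f j) (Gamma (1 - \<alpha>) * p_coeff j s * (real j + k) powr (\<alpha> - 1))" for j
    using has_bochner_integral_mult_right[OF
        has_bochner_integral_Gamma_scaled[of "1 - \<alpha>" "real j + k"], of "p_coeff j s"] assms
    unfolding f_def by (simp add: powr_diff powr_minus field_simps)
  note f = has_bochner_integral_integrable this
  then have int: "integrable halfline (f j)"
    and val: "integral\<^sup>L halfline (f j) = Gamma (1 - \<alpha>) * p_coeff j s * (real j + k) powr (\<alpha> - 1)" for j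
    by (auto simp: has_bochner_integral_iff)
  have "(\<lambda>j. integral\<^sup>L halfline (f j)) sums integral\<^sup>L halfline (beta_exp_kernel \<alpha> s k)"
  proof (rule sums_integral_eventually_const_sign)
    show "integrable halfline (beta_exp_kernel \<alpha> s k)"
      using assms by (intro beta_exp_kernel_integrable)
    show "(\<lambda>j. f j t) sums beta_exp_kernel \<alpha> s k t" if "t \<in> space halfline" for t
    proof -
      have "t > 0" using that by (simp add: space_restrict_space)
      then have "(\<lambda>j. p_coeff j s * exp (- t) ^ j) sums (1 - exp (- t)) powr (s - 1)"
        using assms by (intro p_coeff_sums) auto
      from sums_mult[OF this, of "t powr (- \<alpha>) * exp (- (k * t))"]
      moreover have "exp (- ((real j + k) * t)) = exp (- (k * t)) * exp (- t) ^ j" for j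
        by (simp add: algebra_simps flip: exp_of_nat_mult exp_add)
      ultimately show ?thesis
        by (simp add: f_def beta_exp_kernel_def mult_ac)
    qed
    show "\<bar>f j t\<bar> = e * f j t" if "j \<ge> N" for j t
      using e(2)[OF that] by (simp add: f_def abs_mult)
  qed (use int e in auto)
  then show ?thesis by (simp add: val)
qed

text \<open>The function t^(1 - \<alpha>) e^(-kt) (1 - e^(-t))^(s - 1) tends to 0 at both ends of
  the half-line, so its derivative integrates to 0.\<close>

lemma beta_exp_integral_by_parts:
  assumes "1 < \<alpha>" "\<alpha> < s" "1 \<le> k"
  shows "(1 - \<alpha>) * integral\<^sup>L halfline (beta_exp_kernel \<alpha> s k) =
    k * integral\<^sup>L halfline (beta_exp_kernel (\<alpha> - 1) s k)
    - (s - 1) * integral\<^sup>L halfline (beta_exp_kernel (\<alpha> - 1) (s - 1) (k + 1))"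
proof -
  define F where "F = beta_exp_kernel (\<alpha> - 1) s k"
  \<comment> \<open>The derivative of \<open>F\<close>, one kernel per factor. Differentiating 1 -
    e^(-t) produces the factor e^(-t) that turns k into k + 1.\<close>
  define f where "f t = (1 - \<alpha>) * beta_exp_kernel \<alpha> s k t - k * beta_exp_kernel (\<alpha> - 1) s k t
    + (s - 1) * beta_exp_kernel (\<alpha> - 1) (s - 1) (k + 1) t" for t
  have ivl: "einterval 0 \<infinity> = {0::real<..}"
    by (simp add: zero_ereal_def)
  \<comment> \<open>The third kernel requires s - 1 > 0, which follows from 1 < \<alpha> <
    s.\<close>
  note int = beta_exp_kernel_integrable[of s \<alpha> k] beta_exp_kernel_integrable[of s "\<alpha> - 1" k]
    beta_exp_kernel_integrable[of "s - 1" "\<alpha> - 1" "k + 1"]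
  have int_f: "integrable halfline f"
    unfolding f_def using int assms by auto
  \<comment> \<open>One bound for both ends: the power vanishes at 0 since \<alpha> < s, and the
    exponential wins at infinity.\<close>
  have F_bound: "F t \<le> t powr (s - \<alpha>) * exp (- (k * t))" if "t > 0" for t
  proof -
    have "(1 - exp (- t)) powr (s - 1) \<le> t powr (s - 1)"
      using exp_neg_bounds[OF that] assms by (intro powr_mono2) auto
    then have "F t \<le> t powr (- (\<alpha> - 1)) * exp (- (k * t)) * t powr (s - 1)"
      unfolding F_def beta_exp_kernel_def by (intro mult_left_mono) auto
    then show ?thesis by (simp add: mult_ac flip: powr_add)
  qed
  have "(LBINT t=0..\<infinity>. f t) = 0 - 0"
  proof (rule interval_integral_FTC_integrable)
    show "(F has_vector_derivative f t) (at t)" if "0 < ereal t" for t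
    proof -
      have "t > 0" using that by simp
      have "((\<lambda>t. t powr (- (\<alpha> - 1))) has_real_derivative (1 - \<alpha>) * t powr (- \<alpha>)) (at t)"
        using has_real_derivative_powr[OF \<open>t > 0\<close>, of "- (\<alpha> - 1)"] by simp
      moreover have "((\<lambda>t. exp (- (k * t))) has_real_derivative - k * exp (- (k * t))) (at t)"
        by (auto intro!: derivative_eq_intros)
      moreover have "((\<lambda>t. (1 - exp (- t)) powr (s - 1)) has_real_derivative
          (s - 1) * (1 - exp (- t)) powr (s - 1 - real 1) * exp (- t)) (at t)"
        using \<open>t > 0\<close> by (intro DERIV_fun_powr) (auto intro!: derivative_eq_intros)
      ultimately have "((\<lambda>t. t powr (- (\<alpha> - 1)) * exp (- (k * t)) * (1 - exp (- t)) powr (s - 1))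
          has_real_derivative f t) (at t)"
      proof (rule DERIV_cong[OF DERIV_mult[OF DERIV_mult]])
        have "exp (- ((k + 1) * t)) = exp (- (k * t)) * exp (- t)"
          by (simp add: algebra_simps flip: exp_add)
        then show "((1 - \<alpha>) * t powr - \<alpha> * exp (- (k * t))
            + - k * exp (- (k * t)) * t powr - (\<alpha> - 1)) * (1 - exp (- t)) powr (s - 1)
          + (s - 1) * (1 - exp (- t)) powr (s - 1 - real 1) * exp (- t)
            * (t powr - (\<alpha> - 1) * exp (- (k * t))) = f t"
          by (simp add: f_def beta_exp_kernel_def algebra_simps)
      qed
      then show ?thesis
        by (simp add: F_def beta_exp_kernel_def[abs_def] has_real_derivative_iff_has_vector_derivative)
    qed
    show "isCont f t" if "0 < ereal t" for t
      using that unfolding f_def beta_exp_kernel_def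
      by (auto intro!: continuous_intros)
    show "set_integrable lborel (einterval 0 \<infinity>) f"
      using int_f by (simp add: ivl set_integrable_def integrable_restrict_space)
    have "((\<lambda>t. t powr (s - \<alpha>) * exp (- (k * t))) \<longlongrightarrow> 0) (at_right 0)"
    proof -
      have "((\<lambda>t. t powr (s - \<alpha>)) \<longlongrightarrow> 0) (at_right (0::real))"
        using assms by (auto intro!: tendsto_eq_intros simp: eventually_at_right_less
            eventually_mono[OF eventually_at_right_less] less_imp_le)
      moreover have "((\<lambda>t. exp (- (k * t))) \<longlongrightarrow> exp (- (k * 0))) (at_right 0)"
        by (intro tendsto_intros)
      ultimately show ?thesis
        using tendsto_mult by force
    qed
    then have "(F \<longlongrightarrow> 0) (at_right 0)"
      by (rule real_tendsto_sandwich[OF _ _ tendsto_const, rotated 2])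
        (use F_bound in \<open>auto simp: F_def beta_exp_kernel_nonneg eventually_at_right_less
          intro: eventually_mono[OF eventually_at_right_less]\<close>)
    then show "((F \<circ> real_of_ereal) \<longlongrightarrow> 0) (at_right 0)"
      by (simp add: zero_ereal_def ereal_tendsto_simps)
    have "((\<lambda>t. t powr (s - \<alpha>) * exp (- (k * t))) \<longlongrightarrow> 0) at_top"
      using assms by real_asymp
    then have "(F \<longlongrightarrow> 0) at_top"
      by (rule real_tendsto_sandwich[OF _ _ tendsto_const, rotated 2])
        (use F_bound in \<open>auto simp: F_def beta_exp_kernel_nonneg
          intro: eventually_mono[OF eventually_gt_at_top]\<close>)
    then show "((F \<circ> real_of_ereal) \<longlongrightarrow> 0) (at_left \<infinity>)"
      by (simp add: ereal_tendsto_simps)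
  qed simp
  then have "integral\<^sup>L halfline f = 0"
    by (simp add: interval_lebesgue_integral_def ivl set_lebesgue_integral_def integral_restrict_space)
  then show ?thesis
    unfolding f_def using int assms by simp
qed

text \<open>Induction on a natural upper bound of \<alpha>: integration by parts lowers \<alpha> by
  one. It also changes s and k, so these are generalised too.\<close>

lemma beta_exp_integral_sums:
  assumes "0 < s" "\<alpha> < s" "1 \<le> k" "1 - \<alpha> \<notin> \<int>\<^sub>\<le>\<^sub>0"
  shows "(\<lambda>j. Gamma (1 - \<alpha>) * p_coeff j s * (real j + k) powr (\<alpha> - 1))
    sums integral\<^sup>L halfline (beta_exp_kernel \<alpha> s k)"
proof -
  obtain n where "\<alpha> < real n" using reals_Archimedean2 by blast
  then show ?thesis using assms
  proof (induction n arbitrary: \<alpha> s k)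
    case 0
    then show ?case by (intro beta_exp_integral_sums_lt_1) auto
  next
    case (Suc n)
    show ?case
    proof (cases "\<alpha> < 1")
      case True
      with Suc.prems show ?thesis by (intro beta_exp_integral_sums_lt_1) auto
    next
      case False
      \<comment> \<open>For \<alpha> = 1 the argument 1 - \<alpha> would be the pole 0.\<close>
      have "\<alpha> \<noteq> 1" using Suc.prems by auto
      with False have "\<alpha> > 1" by simp
      have pole: "2 - \<alpha> \<notin> \<int>\<^sub>\<le>\<^sub>0"
      proof
        assume "2 - \<alpha> \<in> \<int>\<^sub>\<le>\<^sub>0"
        then have "2 - \<alpha> - 1 \<in> \<int>\<^sub>\<le>\<^sub>0" by (rule nonpos_Ints_diff_Nats) auto
        then show False using Suc.prems by simp
      qed
      define q where "q j = Gamma (2 - \<alpha>) * p_coeff j s * (real j + k) powr (\<alpha> - 2)" for j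
      have A: "q sums integral\<^sup>L halfline (beta_exp_kernel (\<alpha> - 1) s k)"
        using Suc.IH[of "\<alpha> - 1" s k] Suc.prems pole by (simp add: q_def[abs_def])
      have "(\<lambda>j. - (s - 1) * (Gamma (2 - \<alpha>) * p_coeff j (s - 1) * (real j + (k + 1)) powr (\<alpha> - 2)))
          sums (- (s - 1) * integral\<^sup>L halfline (beta_exp_kernel (\<alpha> - 1) (s - 1) (k + 1)))"
        using Suc.IH[of "\<alpha> - 1" "s - 1" "k + 1"] Suc.prems \<open>\<alpha> > 1\<close> pole
        by (intro sums_mult) simp
      \<comment> \<open>Absorption raises the index to j + 1, and j + (k + 1) = (j + 1) + k fits the
        same shift.\<close>
      also have "(\<lambda>j. - (s - 1) * (Gamma (2 - \<alpha>) * p_coeff j (s - 1) * (real j + (k + 1)) powr (\<alpha> - 2)))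
          = (\<lambda>j. real (Suc j) * q (Suc j))"
      proof
        fix j
        have "- (s - 1) * (Gamma (2 - \<alpha>) * p_coeff j (s - 1) * (real j + (k + 1)) powr (\<alpha> - 2))
          = - ((s - 1) * p_coeff j (s - 1)) * (Gamma (2 - \<alpha>) * (real j + (k + 1)) powr (\<alpha> - 2))"
          by (simp only: mult_ac minus_mult_left minus_mult_right)
        also have "\<dots> = real (Suc j) * q (Suc j)"
          using p_coeff_absorption[of s j] Suc.prems \<open>\<alpha> > 1\<close> by (simp add: q_def add_ac)
        finally show "- (s - 1) * (Gamma (2 - \<alpha>) * p_coeff j (s - 1) * (real j + (k + 1)) powr (\<alpha> - 2))
          = real (Suc j) * q (Suc j)" .
      qed
      \<comment> \<open>The missing term at index 0 is 0 * \<open>q 0\<close>, so the shifted series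
        may start at 0.\<close>
      finally have "(\<lambda>j. real j * q j) sums
          (- (s - 1) * integral\<^sup>L halfline (beta_exp_kernel (\<alpha> - 1) (s - 1) (k + 1)))"
        using sums_Suc[of "\<lambda>j. real j * q j"] by simp
      from sums_divide[OF sums_add[OF sums_mult[OF A, of k] this], of "1 - \<alpha>"]
      have "(\<lambda>j. (k * q j + real j * q j) / (1 - \<alpha>)) sums integral\<^sup>L halfline (beta_exp_kernel \<alpha> s k)"
        using \<open>\<alpha> > 1\<close>
        by (simp only: mult_minus_left add_uminus_conv_diff
            beta_exp_integral_by_parts[OF \<open>\<alpha> > 1\<close> Suc.prems(3,4), symmetric]
            nonzero_mult_div_cancel_left)
      \<comment> \<open>The factor k + j raises the exponent from \<alpha> - 2 to \<alpha> - 1, and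
        Gamma(2 - \<alpha>) = (1 - \<alpha>) Gamma(1 - \<alpha>) absorbs the division.\<close>
      also have "(\<lambda>j. (k * q j + real j * q j) / (1 - \<alpha>))
          = (\<lambda>j. Gamma (1 - \<alpha>) * p_coeff j s * (real j + k) powr (\<alpha> - 1))"
      proof
        fix j
        have "Gamma (2 - \<alpha>) = (1 - \<alpha>) * Gamma (1 - \<alpha>)"
          using Gamma_plus1[of "1 - \<alpha>"] Suc.prems by (simp add: algebra_simps)
        moreover have "(real j + k) * (real j + k) powr (\<alpha> - 2) = (real j + k) powr (\<alpha> - 1)"
          using powr_mult_base[of "real j + k" "\<alpha> - 2"] Suc.prems by simp
        moreover have "k * q j + real j * q j = Gamma (2 - \<alpha>) * p_coeff j s *
            ((real j + k) * (real j + k) powr (\<alpha> - 2))"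
          by (simp add: q_def algebra_simps)
        ultimately show "(k * q j + real j * q j) / (1 - \<alpha>)
            = Gamma (1 - \<alpha>) * p_coeff j s * (real j + k) powr (\<alpha> - 1)"
          using \<open>\<alpha> > 1\<close> by simp
      qed
      finally show ?thesis .
    qed
  qed
qed

section \<open>Existence of the moment forces \<alpha> < ac\<close>

text \<open>A power is monotone in its base, so on [l, 1] it is at least the smaller endpoint value,
  whatever the sign of p.\<close>

lemma powr_ge_min:
  fixes x l p :: real
  assumes "0 < l" "l \<le> x" "x \<le> 1"
  shows "min 1 (l powr p) \<le> x powr p"
proof (cases "p \<ge> 0")
  case True
  then have "l powr p \<le> x powr p" using assms by (intro powr_mono2) auto
  then show ?thesis by simp
next
  case False
  then have "1 powr p \<le> x powr p" using assms by (intro powr_mono2') auto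
  then show ?thesis by simp
qed

text \<open>If \<beta> \<le> -1, then t^\<beta> dominates 1/t on (0, 1], whose integral over
  [\<epsilon>, 1] is unbounded as \<epsilon> shrinks.\<close>

lemma powr_integrable_at_0_imp_gt_neg_1:
  assumes "set_integrable lborel {0<..1} (\<lambda>t::real. t powr \<beta>)"
  shows "\<beta> > - 1"
proof (rule ccontr)
  assume "\<not> \<beta> > - 1"
  define I where "I = (LINT t:{0<..1}|lborel. t powr \<beta>)"
  \<comment> \<open>Chosen so that -ln \<epsilon> = |I| + 1 exceeds \<open>I\<close>.\<close>
  define \<epsilon> where "\<epsilon> = exp (- (\<bar>I\<bar> + 1))"
  have \<epsilon>: "0 < \<epsilon>" "\<epsilon> \<le> 1" by (simp_all add: \<epsilon>_def)
  have FTC: "has_bochner_integral lborel (\<lambda>t. 1 / t * indicator {\<epsilon>..1} t) (ln 1 - ln \<epsilon>)"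
    using \<epsilon> by (intro has_bochner_integral_FTC_Icc_nonneg)
      (auto intro!: derivative_eq_intros continuous_intros)
  have "ln 1 - ln \<epsilon> \<le> I"
    unfolding has_bochner_integral_integral_eq[OF FTC, symmetric] I_def set_lebesgue_integral_def
  proof (rule integral_mono)
    show "integrable lborel (\<lambda>t. 1 / t * indicator {\<epsilon>..1} t)" using FTC by (rule integrable.intros)
    show "integrable lborel (\<lambda>t. indicator {0<..1} t *\<^sub>R t powr \<beta>)"
      using assms by (simp add: set_integrable_def)
    fix t :: real
    show "1 / t * indicator {\<epsilon>..1} t \<le> indicator {0<..1} t *\<^sub>R t powr \<beta>"
    proof (cases "t \<in> {\<epsilon>..1}")
      case True
      then have "t powr (- 1) \<le> t powr \<beta>"
        using \<epsilon> \<open>\<not> \<beta> > - 1\<close> by (intro powr_mono') auto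
      then show ?thesis using True \<epsilon> by (simp add: powr_minus_divide)
    qed (auto simp: indicator_def)
  qed
  then show False by (simp add: \<epsilon>_def)
qed

text \<open>The integrand of the moment after the substitution t = \<gamma> x^(-\<theta>), without
  its constant factor.\<close>

definition moment_kernel :: "real \<Rightarrow> real \<Rightarrow> real \<Rightarrow> real \<Rightarrow> real \<Rightarrow> real" where
  "moment_kernel \<alpha> a b c t =
    beta_exp_kernel \<alpha> (a * c) 1 t * (1 - (1 - exp (- t)) powr c) powr (b - 1)"

lemma borel_measurable_moment_kernel [measurable]:
  "moment_kernel \<alpha> a b c \<in> borel_measurable borel"
  unfolding moment_kernel_def by measurable

text \<open>On (0, 1] the kernel is at least a positive multiple of t^(ac - 1 - \<alpha>), so its
  integrability forces ac - 1 - \<alpha> > -1.\<close>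

lemma moment_kernel_integrable_imp_less:
  assumes "c > 0" and int: "integrable halfline (moment_kernel \<alpha> a b c)"
  shows "\<alpha> < a * c"
proof -
  define l where "l = exp (- 1 :: real)"
  define w where "w = 1 - (1 - l) powr c"
  \<comment> \<open>Product of lower bounds on (0, 1] for e^(-t), for ((1 - e^(-t)) / t)^(ac - 1)
    and for the last factor, whose base is at least \<open>w\<close>.\<close>
  define C where "C = l * min 1 (l powr (a * c - 1)) * min 1 (w powr (b - 1))"
  have l: "0 < l" "l < 1" by (simp_all add: l_def)
  have "(1 - l) powr c < 1 powr c" using l assms by (intro powr_less_mono2) auto
  then have "w > 0" by (simp add: w_def)
  then have "C > 0" using l by (simp add: C_def)
  have bound: "C * t powr (a * c - 1 - \<alpha>) \<le> moment_kernel \<alpha> a b c t" if "0 < t" "t \<le> 1" for t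
  proof -
    note b = exp_neg_bounds[OF \<open>0 < t\<close>]
    have "l \<le> exp (- t)" using that by (simp add: l_def)
    define x where "x = (1 - exp (- t)) / t"
    have x: "l \<le> x" "x \<le> 1" "1 - exp (- t) = t * x"
      using b order_trans[OF mult_left_mono[OF \<open>l \<le> exp (- t)\<close>, of t] b(4)] that
      by (auto simp: x_def pos_le_divide_eq pos_divide_le_eq mult.commute)
    have "t powr (a * c - 1) * min 1 (l powr (a * c - 1)) \<le> t powr (a * c - 1) * x powr (a * c - 1)"
      using l x by (intro mult_left_mono powr_ge_min) auto
    also have "\<dots> = (1 - exp (- t)) powr (a * c - 1)"
      using l x that by (simp add: powr_mult)
    finally have 1: "t powr (a * c - 1) * min 1 (l powr (a * c - 1)) \<le> (1 - exp (- t)) powr (a * c - 1)" .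
    have "(1 - exp (- t)) powr c \<le> (1 - l) powr c"
      using b \<open>l \<le> exp (- t)\<close> assms by (intro powr_mono2) auto
    then have 2: "min 1 (w powr (b - 1)) \<le> (1 - (1 - exp (- t)) powr c) powr (b - 1)"
      using \<open>w > 0\<close> by (intro powr_ge_min) (auto simp: w_def)
    have "C * t powr (a * c - 1 - \<alpha>) = t powr (- \<alpha>) * l
        * (t powr (a * c - 1) * min 1 (l powr (a * c - 1))) * min 1 (w powr (b - 1))"
      by (simp add: C_def mult_ac flip: powr_add)
    also have "\<dots> \<le> t powr (- \<alpha>) * exp (- t) * (1 - exp (- t)) powr (a * c - 1)
        * (1 - (1 - exp (- t)) powr c) powr (b - 1)"
      using l \<open>w > 0\<close> \<open>l \<le> exp (- t)\<close> by (intro mult_mono 1 2) auto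
    finally show ?thesis by (simp add: moment_kernel_def beta_exp_kernel_def)
  qed
  have int': "integrable lborel (\<lambda>t. (indicator {0<..} t *\<^sub>R moment_kernel \<alpha> a b c t) / C)"
    using int by (simp add: integrable_restrict_space)
  have "set_integrable lborel {0<..1} (\<lambda>t. t powr (a * c - 1 - \<alpha>))"
    unfolding set_integrable_def
  proof (rule Bochner_Integration.integrable_bound[OF int'])
    show "AE t in lborel. norm (indicator {0<..1} t *\<^sub>R t powr (a * c - 1 - \<alpha>))
        \<le> norm (indicator {0<..} t *\<^sub>R moment_kernel \<alpha> a b c t / C)"
    proof (rule AE_I2)
      fix t :: real
      show "norm (indicator {0<..1} t *\<^sub>R t powr (a * c - 1 - \<alpha>))
        \<le> norm (indicator {0<..} t *\<^sub>R moment_kernel \<alpha> a b c t / C)"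
      proof (cases "t \<in> {0<..1}")
        case True
        then have "t powr (a * c - 1 - \<alpha>) \<le> moment_kernel \<alpha> a b c t / C"
          using bound[of t] \<open>C > 0\<close> by (simp add: field_simps)
        also have "\<dots> \<le> \<bar>moment_kernel \<alpha> a b c t / C\<bar>" by (rule abs_ge_self)
        finally show ?thesis using True by simp
      qed simp
    qed
  qed measurable
  from powr_integrable_at_0_imp_gt_neg_1[OF this] show ?thesis by simp
qed

section \<open>Change of variables t = \<gamma> x^(-\<theta>)\<close>

text \<open>The change of variables theorem speaks of absolute integrability with respect to
  Lebesgue measure, the completion of \<open>lborel\<close>; for Borel functions both notions
  agree.\<close>

lemma halfline_integrable_iff_absolutely_integrable:
  fixes f :: "real \<Rightarrow> real"
  assumes [measurable]: "f \<in> borel_measurable borel"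
  shows "integrable halfline f \<longleftrightarrow> f absolutely_integrable_on {0<..}"
  by (simp add: set_integrable_def integrable_restrict_space integrable_completion)

lemma halfline_integral_eq_integral:
  fixes f :: "real \<Rightarrow> real"
  assumes "integrable halfline f"
  shows "integral\<^sup>L halfline f = integral {0<..} f"
  using set_borel_integral_eq_integral(2)[of "{0<..}" f] assms
  by (simp add: set_integrable_def integrable_restrict_space integral_restrict_space
      set_lebesgue_integral_def)

text \<open>The map is a decreasing bijection of the half-line, so the absolute value of its
  derivative enters. Integrability passes from x to t, since existence of the moment is given in
  terms of x.\<close>

lemma halfline_powr_substitution:
  fixes f :: "real \<Rightarrow> real" and \<gamma> \<theta> :: real
  assumes "\<gamma> > 0" "\<theta> > 0" and [measurable]: "f \<in> borel_measurable borel"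
    and int: "integrable halfline (\<lambda>x. \<gamma> * \<theta> * x powr (- \<theta> - 1) * f (\<gamma> * x powr (- \<theta>)))"
  shows "integrable halfline f"
    and "integral\<^sup>L halfline (\<lambda>x. \<gamma> * \<theta> * x powr (- \<theta> - 1) * f (\<gamma> * x powr (- \<theta>)))
      = integral\<^sup>L halfline f"
proof -
  define g where "g x = \<gamma> * x powr (- \<theta>)" for x
  define g' where "g' x = - (\<gamma> * \<theta> * x powr (- \<theta> - 1))" for x
  have der: "(g has_field_derivative g' x) (at x within {0<..})" if "x \<in> {0<..}" for x
    using has_real_derivative_powr[of x "- \<theta>"] that
    unfolding g_def g'_def
    by (auto intro!: DERIV_cong[OF DERIV_cmult] intro: has_field_derivative_at_within)
  have inj: "inj_on g {0<..}"
    using assms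
    by (intro inj_on_inverseI[where g = "\<lambda>t. (t / \<gamma>) powr (- 1 / \<theta>)"]) (auto simp: g_def powr_powr)
  have img: "g ` {0<..} = {0<..}"
  proof (intro equalityI subsetI)
    fix t :: real assume "t \<in> {0<..}"
    then have "t = g ((t / \<gamma>) powr (- 1 / \<theta>))" "(t / \<gamma>) powr (- 1 / \<theta>) > 0"
      using assms by (auto simp: g_def powr_powr)
    then show "t \<in> g ` {0<..}" by blast
  qed (use assms in \<open>auto simp: g_def\<close>)
  have eq: "(\<lambda>x. \<gamma> * \<theta> * x powr (- \<theta> - 1) * f (\<gamma> * x powr (- \<theta>))) = (\<lambda>x. \<bar>g' x\<bar> * f (g x))"
    using assms by (auto simp: g_def g'_def abs_mult)
  have m: "(\<lambda>x. \<bar>g' x\<bar> * f (g x)) \<in> borel_measurable borel"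
    unfolding g_def g'_def by measurable
  note cov = has_absolute_integral_change_of_variables_1'[of "{0<..}" g g' f, OF _ der inj, unfolded img]
  have abs: "(\<lambda>x. \<bar>g' x\<bar> * f (g x)) absolutely_integrable_on {0<..}"
    using int unfolding eq halfline_integrable_iff_absolutely_integrable[OF m] .
  then have "f absolutely_integrable_on {0<..}"
    and I: "integral {0<..} f = integral {0<..} (\<lambda>x. \<bar>g' x\<bar> * f (g x))"
    using cov by auto
  then show "integrable halfline f"
    by (simp add: halfline_integrable_iff_absolutely_integrable)
  then show "integral\<^sup>L halfline (\<lambda>x. \<gamma> * \<theta> * x powr (- \<theta> - 1) * f (\<gamma> * x powr (- \<theta>)))
      = integral\<^sup>L halfline f"
    using int unfolding eq by (simp add: halfline_integral_eq_integral I)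
qed

section \<open>The outer series and the moment formula\<close>

text \<open>With u = 1 - e^(-t), the last factor is a binomial series in u^c, and each further power
  of u^c raises s = ac by c.\<close>

lemma moment_kernel_integral_sums:
  assumes "a > 0" "b > 0" "c > 0" and int: "integrable halfline (moment_kernel \<alpha> a b c)"
  shows "(\<lambda>j. p_coeff j b * integral\<^sup>L halfline (beta_exp_kernel \<alpha> (c * (a + real j)) 1))
    sums integral\<^sup>L halfline (moment_kernel \<alpha> a b c)"
proof -
  have "\<alpha> < a * c" using moment_kernel_integrable_imp_less[OF \<open>c > 0\<close> int] .
  obtain N e where e: "\<bar>e\<bar> = 1" "\<And>j. j \<ge> N \<Longrightarrow> \<bar>p_coeff j b\<bar> = e * p_coeff j b"
    using p_coeff_eventually_const_sign[OF \<open>b > 0\<close>] by blast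
  \<comment> \<open>Hence \<alpha> < ac makes all the kernels in the series integrable.\<close>
  have "a * c \<le> c * (a + real j)" for j
    using assms by (simp add: algebra_simps)
  then have intK: "integrable halfline (beta_exp_kernel \<alpha> (c * (a + real j)) 1)" for j
    using assms \<open>\<alpha> < a * c\<close> less_le_trans[of \<alpha> "a * c" "c * (a + real j)"]
    by (intro beta_exp_kernel_integrable) (auto intro!: mult_pos_pos add_pos_nonneg)
  have "(\<lambda>j. integral\<^sup>L halfline (\<lambda>t. p_coeff j b * beta_exp_kernel \<alpha> (c * (a + real j)) 1 t))
    sums integral\<^sup>L halfline (moment_kernel \<alpha> a b c)"
  proof (rule sums_integral_eventually_const_sign)
    show "(\<lambda>j. p_coeff j b * beta_exp_kernel \<alpha> (c * (a + real j)) 1 t) sums moment_kernel \<alpha> a b c t"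
      if "t \<in> space halfline" for t
    proof -
      have "t > 0" using that by (simp add: space_restrict_space)
      define u where "u = 1 - exp (- t)"
      have u: "0 < u" "u < 1" using exp_neg_bounds[OF \<open>t > 0\<close>] by (simp_all add: u_def)
      have "u powr c < 1 powr c" using u \<open>c > 0\<close> by (intro powr_less_mono2) auto
      then have "(\<lambda>j. p_coeff j b * (u powr c) ^ j) sums (1 - u powr c) powr (b - 1)"
        using assms by (intro p_coeff_sums) auto
      from sums_mult[OF this, of "beta_exp_kernel \<alpha> (a * c) 1 t"]
      have "(\<lambda>j. beta_exp_kernel \<alpha> (a * c) 1 t * (p_coeff j b * (u powr c) ^ j))
        sums moment_kernel \<alpha> a b c t"
        by (simp add: moment_kernel_def u_def)
      moreover have "beta_exp_kernel \<alpha> (c * (a + real j)) 1 t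
          = beta_exp_kernel \<alpha> (a * c) 1 t * (u powr c) ^ j" for j
      proof -
        have "u powr (c * (a + real j) - 1) = u powr (a * c - 1) * u powr (c * real j)"
          by (simp add: algebra_simps flip: powr_add)
        also have "u powr (c * real j) = (u powr c) ^ j"
          using u by (simp add: powr_powr powr_realpow[symmetric])
        finally show ?thesis by (simp add: beta_exp_kernel_def u_def)
      qed
      ultimately show ?thesis by (simp add: mult_ac)
    qed
    show "\<bar>p_coeff j b * beta_exp_kernel \<alpha> (c * (a + real j)) 1 t\<bar>
        = e * (p_coeff j b * beta_exp_kernel \<alpha> (c * (a + real j)) 1 t)" if "j \<ge> N" for j t
      using e(2)[OF that] beta_exp_kernel_nonneg by (simp add: abs_mult)
  qed (use intK int e in auto)
  then show ?thesis by simp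
qed

text \<open>Integrability of X^r is assumed because a divergent Bochner integral defaults to 0.
  Excluding the poles of Gamma(1 - r/\<theta>) avoids its default value 0 there, and the summability
  claims give the infinite sums their usual meaning.\<close>

theorem proposition1:
  fixes M :: "'w measure" and X :: "'w \<Rightarrow> real"
    and \<gamma> \<theta> a b c r :: real
  assumes "prob_space M"
    and "\<gamma> > 0" and "\<theta> > 0" and "a > 0" and "b > 0" and "c > 0"
    and "distributed M lborel X (\<lambda>x. ennreal (rGB1_IWei_density \<gamma> \<theta> a b c x))"
    and moment_exists: "integrable M (\<lambda>\<omega>. X \<omega> powr r)"
    and Gamma_defined: "1 - r / \<theta> \<notin> \<int>\<^sub>\<le>\<^sub>0"
  shows "(\<forall>j1. summable (\<lambda>j2.
           p_coeff j2 (c * (a + real j1)) / (real j2 + 1)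
             * ((real j2 + 1) * \<gamma>) powr (r / \<theta>) * Gamma (1 - r / \<theta>)))
       \<and> summable (\<lambda>j1. p_coeff j1 b * (\<Sum>j2.
           p_coeff j2 (c * (a + real j1)) / (real j2 + 1)
             * ((real j2 + 1) * \<gamma>) powr (r / \<theta>) * Gamma (1 - r / \<theta>)))
       \<and> (\<integral>\<omega>. X \<omega> powr r \<partial>M) = c / Beta a b * (\<Sum>j1. p_coeff j1 b * (\<Sum>j2.
           p_coeff j2 (c * (a + real j1)) / (real j2 + 1)
             * ((real j2 + 1) * \<gamma>) powr (r / \<theta>) * Gamma (1 - r / \<theta>)))"
proof -
  define \<alpha> where "\<alpha> = r / \<theta>"
  define D where "D = rGB1_IWei_density \<gamma> \<theta> a b c"
  \<comment> \<open>The power of \<gamma> arises from x^r = \<gamma>^\<alpha> t^(-\<alpha>).\<close>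
  define B where "B = c / Beta a b * \<gamma> powr \<alpha>"
  define h where "h t = B * moment_kernel \<alpha> a b c t" for t
  have "Beta a b > 0"
    using assms by (simp add: Beta_def)
  then have "B > 0" using assms by (simp add: B_def)
  have D_nonneg: "0 \<le> D x" for x
    using assms \<open>Beta a b > 0\<close> by (simp add: D_def rGB1_IWei_density_def)
  have dist: "distributed M lborel X (\<lambda>x. ennreal (D x))"
    using assms by (simp add: D_def)
  have h_meas: "h \<in> borel_measurable borel"
    unfolding h_def by measurable
  have subst: "D x * x powr r
      = indicator {0<..} x *\<^sub>R (\<gamma> * \<theta> * x powr (- \<theta> - 1) * h (\<gamma> * x powr (- \<theta>)))" for x
  proof (cases "x > 0")
    case True
    have "(\<gamma> * x powr (- \<theta>)) powr (- \<alpha>) = \<gamma> powr (- \<alpha>) * x powr r"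
      using True assms by (simp add: powr_mult powr_powr \<alpha>_def)
    moreover have "\<gamma> powr \<alpha> * \<gamma> powr (- \<alpha>) = 1"
      using assms by (simp flip: powr_add)
    ultimately have "\<gamma> powr \<alpha> * (\<gamma> * x powr (- \<theta>)) powr (- \<alpha>) = x powr r"
      by (simp flip: mult.assoc)
    then show ?thesis
      using True
      by (simp add: D_def rGB1_IWei_density_def h_def B_def moment_kernel_def beta_exp_kernel_def
          mult_ac)
  qed (simp add: D_def rGB1_IWei_density_def)
  have "integrable lborel (\<lambda>x. D x * x powr r)"
    using distributed_integrable[OF dist, of "\<lambda>x. x powr r"] moment_exists D_nonneg by simp
  then have int: "integrable halfline (\<lambda>x. \<gamma> * \<theta> * x powr (- \<theta> - 1) * h (\<gamma> * x powr (- \<theta>)))"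
    by (simp add: subst integrable_restrict_space)
  note change = halfline_powr_substitution[OF \<open>\<gamma> > 0\<close> \<open>\<theta> > 0\<close> h_meas int]
  have int_m: "integrable halfline (moment_kernel \<alpha> a b c)"
    using change(1) \<open>B > 0\<close> unfolding h_def by simp
  have "\<alpha> < a * c" using moment_kernel_integrable_imp_less[OF \<open>c > 0\<close> int_m] .
  have "(\<integral>\<omega>. X \<omega> powr r \<partial>M) = (\<integral>x. D x * x powr r \<partial>lborel)"
    using distributed_integral[OF dist, of "\<lambda>x. x powr r"] D_nonneg by simp
  also have "\<dots> = integral\<^sup>L halfline h"
    using change(2) by (simp add: subst integral_restrict_space)
  finally have moment: "(\<integral>\<omega>. X \<omega> powr r \<partial>M) = B * integral\<^sup>L halfline (moment_kernel \<alpha> a b c)"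
    by (simp add: h_def[abs_def])

  define K where "K j = integral\<^sup>L halfline (beta_exp_kernel \<alpha> (c * (a + real j)) 1)" for j :: nat
  \<comment> \<open>Each inner sum keeps a factor \<gamma>^\<alpha>; moreover (j + 1)^(\<alpha> - 1)
    = (j + 1)^\<alpha> / (j + 1).\<close>
  have inner: "(\<lambda>j2. p_coeff j2 (c * (a + real j1)) / (real j2 + 1)
      * ((real j2 + 1) * \<gamma>) powr (r / \<theta>) * Gamma (1 - r / \<theta>)) sums (\<gamma> powr \<alpha> * K j1)" for j1
  proof -
    have "a * c \<le> c * (a + real j1)" using assms by (simp add: algebra_simps)
    then have "\<alpha> < c * (a + real j1)" using \<open>\<alpha> < a * c\<close> by simp
    moreover have "0 < c * (a + real j1)" using assms by (intro mult_pos_pos add_pos_nonneg) auto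
    ultimately have "(\<lambda>j. \<gamma> powr \<alpha> *
        (Gamma (1 - \<alpha>) * p_coeff j (c * (a + real j1)) * (real j + 1) powr (\<alpha> - 1))) sums (\<gamma> powr \<alpha> * K j1)"
      unfolding K_def using Gamma_defined by (intro sums_mult beta_exp_integral_sums) (auto simp: \<alpha>_def)
    moreover have "\<gamma> powr \<alpha> * (Gamma (1 - \<alpha>) * p_coeff j (c * (a + real j1)) * (real j + 1) powr (\<alpha> - 1))
      = p_coeff j (c * (a + real j1)) / (real j + 1) * ((real j + 1) * \<gamma>) powr (r / \<theta>) * Gamma (1 - r / \<theta>)" for j
      using assms by (simp add: \<alpha>_def powr_mult powr_diff)
    ultimately show ?thesis by simp
  qed
  have outer: "(\<lambda>j1. p_coeff j1 b * (\<gamma> powr \<alpha> * K j1))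
      sums (\<gamma> powr \<alpha> * integral\<^sup>L halfline (moment_kernel \<alpha> a b c))"
    using sums_mult[OF moment_kernel_integral_sums[OF \<open>a > 0\<close> \<open>b > 0\<close> \<open>c > 0\<close> int_m], of "\<gamma> powr \<alpha>"]
    by (simp add: K_def mult.left_commute)
  show ?thesis
    \<comment> \<open>The outer sum carries the factor \<gamma>^\<alpha> of \<open>B\<close>, so
      just c / B(a, b) stays in front.\<close>
    unfolding sums_unique[OF inner, symmetric] sums_unique[OF outer, symmetric] moment
    using inner outer by (auto simp: sums_iff B_def)
qed

end
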